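(* Let $(c, c_F)$ be a contact congruence in Lorentz space $\mathbf{L}^3$. For $v\in\mathbb{Z}^2$ and $f\in F(\mathbb{Z}^2)$ put $$p(v) = c(v)\cap \mathbf{E}^2,\qquad p_F(f) = c_F(f)\cap \mathbf{E}^2 .$$ Then $(p,p_F)$ is a circle pattern. Moreover, for every $v\in\mathbb{Z}^2$ the center of the circle $p(v)$ is the orthogonal projection onto $\mathbf{E}^2$ of the center of the sphere $c(v)$.
   Context: $\mathbb{Z}^2$ denotes the vertex set of the square lattice graph (edges join vertices differing by $\pm e_1$ or $\pm e_2$) and $F(\mathbb{Z}^2)$ its set of unit square faces. Lorentz space $\mathbf{L}^3$ is $\mathbb{R}^3$ with the bilinear form $\langle x,y\rangle = x_1y_1+x_2y_2-x_3y_3$. The Euclidean plane is embedded as $\mathbf{E}^2=\{x\in\mathbf{L}^3: x_3=0\}$; orthogonal projection onto $\mathbf{E}^2$ is $(x_1,x_2,x_3)\mapsto(x_1,x_2,0)$. Circles in $\mathbf{E}^2$ are ordinary Euclidean circles; radius $0$ (a single point) is allowed. Oriented spheres: an oriented timelike sphere is given by a center $m\in\mathbf{L}^3$ and a signed radius $r\in\mathbb{R}\setminus\{0\}$; its point set is $\{x:\langle x-m,x-m\rangle=r^2\}$, and it is oriented outwards if $r>0$ and inwards if $r<0$. A null-sphere with center $m$ is the point set $\{x:\langle x-m,x-m\rangle=0\}$ (signed radius $0$, no orientation). Oriented isotropic lines: an isotropic line is $L=\{q+td:t\in\mathbb{R}\}$ with $d\neq0$, $\langle d,d\rangle=0$.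 It lies in a unique isotropic plane $H_L=\{x:\langle x-q,d\rangle=0\}$. An orientation of $L$ is the choice of one of the two components $\Omega$ of $H_L\setminus L$. Oriented contact of a sphere with an oriented isotropic line $(L,\Omega)$: a null-sphere is in contact with it iff its center lies on $L$ (equivalently the null-sphere contains $L$). An oriented timelike sphere with center $m$ and signed radius $r$ is in contact with it iff it contains $L$ (which forces $m\in H_L\setminus L$) and $m\notin\Omega$ if $r>0$, $m\in\Omega$ if $r<0$. A contact congruence is a pair of maps $c$, $c_F$, where $c$ assigns to each $v\in\mathbb{Z}^2$ an oriented timelike sphere or a null-sphere and $c_F$ assigns to each $f\in F(\mathbb{Z}^2)$ an oriented isotropic line, such that $c(v)$ is in oriented contact with $c_F(f)$ whenever $v$ and $f$ are incident. A circle pattern is a pair of maps $p$ from $\mathbb{Z}^2$ to circles in $\mathbf{E}^2$ and $p_F:F(\mathbb{Z}^2)\to\mathbf{E}^2$ such that the circle $p(v)$ contains the point $p_F(f)$ whenever $v$ and $f$ are incident. *)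

theory Defs
  imports "HOL-Analysis.Analysis"
begin

type_synonym vertex = "int \<times> int"

text \<open>A unit square face is identified with the set of its four corners, so that a vertex
  \<open>v\<close> is incident to a face \<open>f\<close> iff \<open>v \<in> f\<close>.\<close>

type_synonym face = "vertex set"

definition faces :: "face set" where
  "faces = {{(i, j), (i + 1, j), (i + 1, j + 1), (i, j + 1)} | i j. True}"

definition lorentz :: "real^3 \<Rightarrow> real^3 \<Rightarrow> real" where
  "lorentz x y = x $ 1 * y $ 1 + x $ 2 * y $ 2 - x $ 3 * y $ 3"

definition euclidean_plane :: "(real^3) set" where
  "euclidean_plane = {x. x $ 3 = 0}"

definition plane_projection :: "real^3 \<Rightarrow> real^3" where
  "plane_projection x = vector [x $ 1, x $ 2, 0]"

text \<open>On \<open>euclidean_plane\<close> the Lorentz form coincides with the standard inner product, so the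
  library's Euclidean \<^const>\<open>sphere\<close> may be used to describe circles.\<close>

definition circle_with :: "real^3 \<Rightarrow> real \<Rightarrow> (real^3) set \<Rightarrow> bool" where
  "circle_with a \<rho> C \<longleftrightarrow>
     a \<in> euclidean_plane \<and> \<rho> \<ge> 0 \<and> C = euclidean_plane \<inter> sphere a \<rho>"

definition is_circle :: "(real^3) set \<Rightarrow> bool" where
  "is_circle C \<longleftrightarrow> (\<exists>a \<rho>. circle_with a \<rho> C)"

definition circle_center :: "(real^3) set \<Rightarrow> real^3" where
  "circle_center C = (THE a. \<exists>\<rho>. circle_with a \<rho> C)"

text \<open>Signed radius \<open>0\<close> encodes a null-sphere; otherwise the sphere is an oriented timelike
  sphere whose orientation is the sign of the radius.\<close>

datatype lsphere = LSphere (lcenter: "real^3") (sradius: real)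

definition sphere_points :: "lsphere \<Rightarrow> (real^3) set" where
  "sphere_points S = {x. lorentz (x - lcenter S) (x - lcenter S) = (sradius S)\<^sup>2}"

definition isotropic_line :: "real^3 \<Rightarrow> real^3 \<Rightarrow> (real^3) set" where
  "isotropic_line q d = {q + t *\<^sub>R d | t. True}"

definition isotropic_plane :: "real^3 \<Rightarrow> real^3 \<Rightarrow> (real^3) set" where
  "isotropic_plane q d = {x. lorentz (x - q) d = 0}"

text \<open>An oriented isotropic line is a pair \<open>(L, \<Omega>)\<close> of point sets. Neither the line nor the
  plane depends on the choice of \<open>q\<close> on \<open>L\<close> and of the direction \<open>d\<close> of \<open>L\<close>.\<close>

type_synonym oriented_line = "(real^3) set \<times> (real^3) set"

definition oriented_isotropic_line :: "oriented_line \<Rightarrow> bool" where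
  "oriented_isotropic_line = (\<lambda>(L, \<Omega>). \<exists>q d. d \<noteq> 0 \<and> lorentz d d = 0 \<and>
     L = isotropic_line q d \<and> \<Omega> \<in> components (isotropic_plane q d - L))"

definition oriented_contact :: "lsphere \<Rightarrow> oriented_line \<Rightarrow> bool" where
  "oriented_contact S = (\<lambda>(L, \<Omega>).
     if sradius S = 0 then lcenter S \<in> L
     else L \<subseteq> sphere_points S \<and>
       (if sradius S > 0 then lcenter S \<notin> \<Omega> else lcenter S \<in> \<Omega>))"

definition contact_congruence ::
    "(vertex \<Rightarrow> lsphere) \<Rightarrow> (face \<Rightarrow> oriented_line) \<Rightarrow> bool" where
  "contact_congruence c cF \<longleftrightarrow>
     (\<forall>f\<in>faces. oriented_isotropic_line (cF f)) \<and>
     (\<forall>v. \<forall>f\<in>faces. v \<in> f \<longrightarrow> oriented_contact (c v) (cF f))"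

definition circle_pattern ::
    "(vertex \<Rightarrow> (real^3) set) \<Rightarrow> (face \<Rightarrow> real^3) \<Rightarrow> bool" where
  "circle_pattern p pF \<longleftrightarrow>
     (\<forall>v. is_circle (p v)) \<and>
     (\<forall>f\<in>faces. pF f \<in> euclidean_plane) \<and>
     (\<forall>v. \<forall>f\<in>faces. v \<in> f \<longrightarrow> pF f \<in> p v)"

end

theory Submission
  imports Defs
begin

text \<open>Setting \<open>x $ 3 = 0\<close> in the equation of a sphere with center
  \<open>m\<close> and signed radius \<open>r\<close> leaves the circle about the projection of
  \<open>m\<close> with squared radius \<open>r\<^sup>2 + (m $ 3)\<^sup>2\<close>, which is never
  negative (\<open>circle_with_sphere_points_Int\<close>). An isotropic direction is never
  horizontal, so an isotropic line crosses the plane exactly once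
  (\<open>isotropic_line_Int_euclidean_plane\<close>). Contact puts the whole line on the sphere
  (\<open>oriented_contact_subset_sphere_points\<close>), so the crossing point lies on the circle.
  Speaking of the center of a circle is legitimate because the point set determines it, even at
  radius 0 (\<open>circle_with_center_eq\<close>).\<close>

lemma mem_circle_with_iff:
  assumes "circle_with a \<rho> C"
  shows "x \<in> C \<longleftrightarrow> x $ 3 = 0 \<and> (x $ 1 - a $ 1)\<^sup>2 + (x $ 2 - a $ 2)\<^sup>2 = \<rho>\<^sup>2"
proof -
  have a: "a $ 3 = 0" and \<rho>: "\<rho> \<ge> 0" and C: "C = euclidean_plane \<inter> sphere a \<rho>"
    using assms by (auto simp: circle_with_def euclidean_plane_def)
  have "dist a x = \<rho> \<longleftrightarrow> (dist a x)\<^sup>2 = \<rho>\<^sup>2"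
    using \<rho> by simp
  moreover have "(dist a x)\<^sup>2 = (x $ 1 - a $ 1)\<^sup>2 + (x $ 2 - a $ 2)\<^sup>2" if "x $ 3 = 0"
    unfolding dist_norm power2_norm_eq_inner using a that
    by (simp add: inner_vec_def sum_3 power2_eq_square algebra_simps)
  ultimately show ?thesis
    using C by (auto simp: euclidean_plane_def)
qed

lemma circle_with_center_eq:
  assumes "circle_with a \<rho> C" "circle_with b \<sigma> C"
  shows "a = b"
proof -
  \<comment> \<open>The side condition excludes only \<open>\<rho> = 0\<close> with
    \<open>\<sigma> \<noteq> 0\<close>; there the two circles can be swapped, so one of the two
    orders always applies.\<close>
  have eq: "b = a"
    if a: "circle_with a \<rho> C" and b: "circle_with b \<sigma> C" and "\<sigma> = 0 \<or> \<rho> \<noteq> 0"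
    for a b :: "real^3" and \<rho> \<sigma>
  proof -
    define P where "P s t = (vector [a $ 1 + s, a $ 2 + t, 0] :: real^3)" for s t
    have P: "(a $ 1 + s - b $ 1)\<^sup>2 + (a $ 2 + t - b $ 2)\<^sup>2 = \<sigma>\<^sup>2" if "s\<^sup>2 + t\<^sup>2 = \<rho>\<^sup>2" for s t
    proof -
      have "P s t \<in> C"
        using that by (simp add: mem_circle_with_iff[OF a] P_def vector_3)
      then show ?thesis
        by (simp add: mem_circle_with_iff[OF b] P_def vector_3)
    qed
    \<comment> \<open>Both ends of an axis-parallel diameter about \<open>a\<close> are at distance
      \<open>\<sigma>\<close> from \<open>b\<close>; the two squares differ by
      \<open>4 * \<rho> * (a $ 1 - b $ 1)\<close>.\<close>
    have "(a $ 1 + \<rho> - b $ 1)\<^sup>2 = (a $ 1 - \<rho> - b $ 1)\<^sup>2"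
      using P[of \<rho> 0] P[of "-\<rho>" 0] by simp
    then have "\<rho> * (a $ 1 - b $ 1) = 0"
      by algebra
    moreover have "(a $ 2 + \<rho> - b $ 2)\<^sup>2 = (a $ 2 - \<rho> - b $ 2)\<^sup>2"
      using P[of 0 \<rho>] P[of 0 "-\<rho>"] by simp
    then have "\<rho> * (a $ 2 - b $ 2) = 0"
      by algebra
    moreover have "a $ 3 = 0" "b $ 3 = 0"
      using a b by (auto simp: circle_with_def euclidean_plane_def)
    \<comment> \<open>Diameters say nothing about a point circle; here \<open>\<sigma> = 0\<close>
      too, and \<open>a\<close> itself lies at distance 0 from \<open>b\<close>.\<close>
    moreover have "a $ 1 = b $ 1 \<and> a $ 2 = b $ 2" if "\<rho> = 0"
      using P[of 0 0] that \<open>\<sigma> = 0 \<or> \<rho> \<noteq> 0\<close> by (simp add: sum_power2_eq_zero_iff)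
    ultimately show ?thesis
      by (auto simp: vec_eq_iff forall_3)
  qed
  show ?thesis
    using eq[OF assms] eq[OF assms(2,1)] by blast
qed

lemma circle_center_eq: "circle_with a \<rho> C \<Longrightarrow> circle_center C = a"
  unfolding circle_center_def by (blast intro: the_equality circle_with_center_eq)

lemma circle_with_sphere_points_Int:
  "circle_with (plane_projection (lcenter S)) (sqrt ((sradius S)\<^sup>2 + (lcenter S $ 3)\<^sup>2))
     (sphere_points S \<inter> euclidean_plane)"
  (is "circle_with ?a ?\<rho> ?C")
proof -
  have c: "circle_with ?a ?\<rho> (euclidean_plane \<inter> sphere ?a ?\<rho>)"
    by (simp add: circle_with_def euclidean_plane_def plane_projection_def vector_3)
  have "x \<in> ?C \<longleftrightarrow> x \<in> euclidean_plane \<inter> sphere ?a ?\<rho>" for x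
    unfolding mem_circle_with_iff[OF c]
    by (auto simp: sphere_points_def lorentz_def euclidean_plane_def plane_projection_def
        vector_3 power2_eq_square)
  then have "?C = euclidean_plane \<inter> sphere ?a ?\<rho>"
    by blast
  with c show ?thesis
    by simp
qed

lemma isotropic_line_Int_euclidean_plane:
  assumes "d \<noteq> 0" "lorentz d d = 0"
  shows "\<exists>x. isotropic_line q d \<inter> euclidean_plane = {x}"
proof -
  \<comment> \<open>Otherwise isotropy would read
    \<open>(d $ 1)\<^sup>2 + (d $ 2)\<^sup>2 = 0\<close>, forcing \<open>d = 0\<close>.\<close>
  have "d $ 3 \<noteq> 0"
    using assms by (auto simp: lorentz_def vec_eq_iff forall_3 sum_squares_eq_zero_iff)
  then have "q $ 3 + t * d $ 3 = 0 \<longleftrightarrow> t = - (q $ 3 / d $ 3)" for t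
    by (auto simp: field_simps)
  then obtain s where "\<And>t. q $ 3 + t * d $ 3 = 0 \<longleftrightarrow> t = s"
    by blast
  then have "isotropic_line q d \<inter> euclidean_plane = {q + s *\<^sub>R d}"
    by (auto simp: isotropic_line_def euclidean_plane_def)
  then show ?thesis
    by blast
qed

text \<open>For nonzero radius this is part of the definition of contact. For a null-sphere with
  center on the line, points of the line differ from the center by multiples of the isotropic
  direction, so their Lorentz square vanishes.\<close>

lemma oriented_contact_subset_sphere_points:
  assumes "oriented_isotropic_line l" "oriented_contact S l"
  shows "fst l \<subseteq> sphere_points S"
proof (cases "sradius S = 0")
  case True
  obtain q d where d: "lorentz d d = 0" and L: "fst l = isotropic_line q d"
    using assms(1) by (auto simp: oriented_isotropic_line_def)
  obtain s where s: "lcenter S = q + s *\<^sub>R d"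
    using assms(2) True L by (auto simp: oriented_contact_def isotropic_line_def split: prod.splits)
  have "lorentz (q + t *\<^sub>R d - lcenter S) (q + t *\<^sub>R d - lcenter S) = (t - s)\<^sup>2 * lorentz d d" for t
    by (simp add: s lorentz_def power2_eq_square algebra_simps)
  then show ?thesis
    using True d by (auto simp: L isotropic_line_def sphere_points_def)
next
  case False
  then show ?thesis
    using assms(2) by (auto simp: oriented_contact_def split: prod.splits)
qed

theorem theorem2p4:
  fixes c :: "vertex \<Rightarrow> lsphere"
    and cF :: "face \<Rightarrow> oriented_line"
    and p :: "vertex \<Rightarrow> (real^3) set"
  assumes "contact_congruence c cF"
    and "\<And>v. p v = sphere_points (c v) \<inter> euclidean_plane"
  shows "\<exists>pF. (\<forall>f\<in>faces. fst (cF f) \<inter> euclidean_plane = {pF f}) \<and>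
              circle_pattern p pF \<and>
              (\<forall>v. circle_center (p v) = plane_projection (lcenter (c v)))"
proof -
  have line: "oriented_isotropic_line (cF f)" if "f \<in> faces" for f
    using assms(1) that by (simp add: contact_congruence_def)
  have contact: "oriented_contact (c v) (cF f)" if "f \<in> faces" "v \<in> f" for v f
    using assms(1) that unfolding contact_congruence_def by blast
  have "\<exists>x. fst (cF f) \<inter> euclidean_plane = {x}" if "f \<in> faces" for f
    using line[OF that] isotropic_line_Int_euclidean_plane
    by (auto simp: oriented_isotropic_line_def)
  \<comment> \<open>Outside \<open>faces\<close> the values of \<open>pF\<close> are
    arbitrary.\<close>
  then obtain pF where pF: "\<And>f. f \<in> faces \<Longrightarrow> fst (cF f) \<inter> euclidean_plane = {pF f}"
    by metis
  have circle: "circle_with (plane_projection (lcenter (c v)))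
      (sqrt ((sradius (c v))\<^sup>2 + (lcenter (c v) $ 3)\<^sup>2)) (p v)" for v
    unfolding assms(2) by (rule circle_with_sphere_points_Int)
  have "pF f \<in> p v" if "f \<in> faces" "v \<in> f" for v f
    using pF[OF that(1)] oriented_contact_subset_sphere_points[OF line contact, OF that(1) that]
    by (auto simp: assms(2))
  moreover have "pF f \<in> euclidean_plane" if "f \<in> faces" for f
    using pF[OF that] by blast
  moreover have "is_circle (p v)" for v
    unfolding is_circle_def using circle by blast
  ultimately have "circle_pattern p pF"
    by (simp add: circle_pattern_def)
  with pF circle_center_eq[OF circle] show ?thesis
    by blast
qed

end
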